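(* For every $n\ge1$, let $R_n:=\max A_n$ be the largest atom of the vacuum distribution of a sum of $n$ monotone position operators, where $A_n\subset\mathbb{R}$ is the finite set defined recursively by $A_1=\{1,-1\}$ and $$A_{n+1}=\left\{\frac{r+\sqrt{r^2+4}}{2},\ \frac{r-\sqrt{r^2+4}}{2}\ :\ r\in A_n\right\}.$$ Then $$\sqrt{2n-\sqrt{2n}}\ \le\ R_n\ <\ \sqrt{2n}.$$
   Context: $A_n$ is the set of the $2^n$ atoms of the probability measure $\mu_n$ on $\mathbb{R}$ that is the distribution, in the vacuum state, of $S_n=\sum_{i=1}^n (a_i+a_i^\dagger)$, where $a_i^\dagger,a_i$ ($i\in\mathbb{N}=\{1,2,\ldots\}$) are the monotone creation and annihilation operators on the Hilbert space with orthonormal basis $\Omega$ (the vacuum) and $e_{(i_1,\ldots,i_k)}$, $k\ge1$, $i_1<\cdots<i_k$ in $\mathbb{N}$: $a_i^\dagger\Omega=e_{(i)}$, $a_i^\dagger e_{(i_1,\ldots,i_k)}=e_{(i,i_1,\ldots,i_k)}$ if $i<i_1$ and $0$ otherwise, and $a_i$ is the adjoint of $a_i^\dagger$. The vacuum distribution of $S_n$ is the probability measure with $p$-th moment $\langle S_n^p\Omega,\Omega\rangle$ for all $p\ge0$. *)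

theory Defs
  imports "HOL-Probability.Probability"
begin

text \<open>
  The Hilbert space with orthonormal basis \<open>\<Omega>\<close> and \<open>e\<^sub>(\<^sub>i\<^sub>1\<^sub>,\<^sub>\<dots>\<^sub>,\<^sub>i\<^sub>k\<^sub>)\<close>, \<open>1 \<le> i\<^sub>1 < \<dots> < i\<^sub>k\<close>, is
  realised as the complex \<open>\<ell>\<^sup>2\<close> space over the strictly increasing lists of positive
  integers. The empty list is the index of the vacuum \<open>\<Omega>\<close>.
\<close>

definition mono_index :: "nat list set" where
  "mono_index = {s. sorted_wrt (<) s \<and> (\<forall>i\<in>set s. 1 \<le> i)}"

definition mono_fock :: "(nat list \<Rightarrow> complex) set" where
  "mono_fock = {f. (\<forall>s. s \<notin> mono_index \<longrightarrow> f s = 0) \<and>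
                   (\<lambda>s. (cmod (f s))\<^sup>2) summable_on mono_index}"

definition fock_inner :: "(nat list \<Rightarrow> complex) \<Rightarrow> (nat list \<Rightarrow> complex) \<Rightarrow> complex" where
  "fock_inner f g = (\<Sum>\<^sub>\<infinity>s\<in>mono_index. f s * cnj (g s))"

definition basis_vec :: "nat list \<Rightarrow> nat list \<Rightarrow> complex" where
  "basis_vec s = (\<lambda>t. if t = s then 1 else 0)"

definition vacuum :: "nat list \<Rightarrow> complex" where
  "vacuum = basis_vec []"

definition creation_on_basis :: "nat \<Rightarrow> nat list \<Rightarrow> nat list \<Rightarrow> complex" where
  "creation_on_basis i s = (if s = [] \<or> i < hd s then basis_vec (i # s) else (\<lambda>_. 0))"

text \<open>
  The bounded linear extension of the action on basis vectors. For \<open>i \<ge> 1\<close>, at most one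
  summand is nonzero at each coordinate \<open>t\<close>.
\<close>

definition creation :: "nat \<Rightarrow> (nat list \<Rightarrow> complex) \<Rightarrow> nat list \<Rightarrow> complex" where
  "creation i f = (\<lambda>t. \<Sum>\<^sub>\<infinity>s\<in>mono_index. f s * creation_on_basis i s t)"

text \<open>Meaningful only for bounded operators on, and arguments \<open>g\<close> in, \<^const>\<open>mono_fock\<close>.\<close>

definition fock_adjoint ::
  "((nat list \<Rightarrow> complex) \<Rightarrow> nat list \<Rightarrow> complex) \<Rightarrow> (nat list \<Rightarrow> complex) \<Rightarrow> nat list \<Rightarrow> complex" where
  "fock_adjoint T g =
     (THE h. h \<in> mono_fock \<and> (\<forall>f\<in>mono_fock. fock_inner (T f) g = fock_inner f h))"

definition annihilation :: "nat \<Rightarrow> (nat list \<Rightarrow> complex) \<Rightarrow> nat list \<Rightarrow> complex" where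
  "annihilation i = fock_adjoint (creation i)"

definition position_sum :: "nat \<Rightarrow> (nat list \<Rightarrow> complex) \<Rightarrow> nat list \<Rightarrow> complex" where
  "position_sum n f = (\<lambda>t. \<Sum>i=1..n. annihilation i f t + creation i f t)"

definition vacuum_distribution :: "nat \<Rightarrow> real measure" where
  "vacuum_distribution n =
     (THE \<mu>. prob_space \<mu> \<and> sets \<mu> = sets borel \<and>
        (\<forall>p::nat. integrable \<mu> (\<lambda>x. x ^ p) \<and>
           complex_of_real (\<integral>x. x ^ p \<partial>\<mu>) = fock_inner ((position_sum n ^^ p) vacuum) vacuum))"

definition atoms :: "real measure \<Rightarrow> real set" where
  "atoms \<mu> = {x. 0 < measure \<mu> {x}}"

text \<open>The set \<open>A\<^sub>n\<close>, \<open>n \<ge> 1\<close>. The value at \<open>0\<close> is a mere convention.\<close>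

fun A :: "nat \<Rightarrow> real set" where
  "A 0 = {0}"
| "A (Suc 0) = {1, -1}"
| "A (Suc (Suc n)) =
     (\<Union>r\<in>A (Suc n). {(r + sqrt (r\<^sup>2 + 4)) / 2, (r - sqrt (r\<^sup>2 + 4)) / 2})"

end

theory Submission imports Defs begin

text \<open>
  The sum \<open>S\<^sub>n\<close> is diagonalised explicitly. Put \<open>B x = x - 1 / x\<close>. The numbers
  \<open>(r \<plusminus> \<surd>(r\<^sup>2 + 4)) / 2\<close> are the two solutions of \<open>B x = r\<close>, so \<open>A\<^sub>n\<close> consists of
  the \<open>x\<close> whose orbit \<open>x\<^sub>1 = x\<close>, \<open>x\<^sub>i\<^sub>+\<^sub>1 = B x\<^sub>i\<close> has nonzero \<open>x\<^sub>1, \<dots>, x\<^sub>n\<close> and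
  \<open>x\<^sub>n\<^sub>+\<^sub>1 = 0\<close>. For such an \<open>x\<close> let \<open>v(s) = w \<Prod>\<^sub>i\<^sub>\<in>\<^sub>s 1 / x\<^sub>i\<close> for increasing
  lists \<open>s\<close> in \<open>{1..n}\<close>. At a list with head \<open>k\<close>, annihilators contribute
  \<open>v(s) \<Sum>\<^sub>i\<^sub><\<^sub>k 1 / x\<^sub>i\<close>, which telescopes to \<open>v(s) (x - x\<^sub>k)\<close> because
  \<open>1 / x\<^sub>i = x\<^sub>i - x\<^sub>i\<^sub>+\<^sub>1\<close>, and the creator of \<open>k\<close> contributes \<open>v(s) x\<^sub>k\<close>. At the
  empty list the sum is \<open>v(s) (x - x\<^sub>n\<^sub>+\<^sub>1)\<close>. Hence \<open>S\<^sub>n v = x v\<close>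
  (\<open>spectral_component_eigenvector\<close>).

  With \<open>w = \<Prod>\<^sub>i x\<^sub>i\<^sup>2 / (1 + x\<^sub>i\<^sup>2) > 0\<close> these eigenvectors add up to the vacuum
  (\<open>vacuum_spectral_decomposition\<close>): by induction this reduces to two identities for the pair
  of solutions of \<open>B x = r\<close>. Applying \<open>S\<^sub>n\<close> repeatedly shows that the moments of \<open>S\<^sub>n\<close>
  are those of the measure with mass \<open>w\<close> at each \<open>x \<in> A\<^sub>n\<close>. A finitely supported
  measure is determined by its moments (\<open>finite_support_measure_determinate\<close>), so this is the
  vacuum distribution, and since all masses are positive, its set of atoms is \<open>A\<^sub>n\<close>.

  The largest atom satisfies \<open>B R\<^sub>n\<^sub>+\<^sub>1 = R\<^sub>n\<close>. Squaring gives
  \<open>R\<^sub>n\<^sub>+\<^sub>1\<^sup>2 = R\<^sub>n\<^sup>2 + 2 - 1 / R\<^sub>n\<^sub>+\<^sub>1\<^sup>2\<close>, from which the upper bound is immediate.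
  The same relation gives the crude bound \<open>R\<^sub>n\<^sup>2 \<ge> n\<close>; fed back into it, this makes the
  correction terms small enough to be dominated by the increments of \<open>\<surd>(2n)\<close>.
\<close>

section \<open>The Boole map and the sets \<open>A\<^sub>n\<close>\<close>

definition boole :: "real \<Rightarrow> real" where
  "boole x = x - 1 / x"

definition plus_root :: "real \<Rightarrow> real" where
  "plus_root r = (r + sqrt (r\<^sup>2 + 4)) / 2"

definition minus_root :: "real \<Rightarrow> real" where
  "minus_root r = (r - sqrt (r\<^sup>2 + 4)) / 2"

lemma plus_root_pos: "plus_root r > 0"
proof -
  have "sqrt (r\<^sup>2) < sqrt (r\<^sup>2 + 4)" by (subst real_sqrt_less_iff) simp
  then have "\<bar>r\<bar> < sqrt (r\<^sup>2 + 4)" by simp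
  then show ?thesis unfolding plus_root_def by (simp add: abs_if split: if_splits)
qed

lemma minus_root_neg: "minus_root r < 0"
proof -
  have "sqrt (r\<^sup>2) < sqrt (r\<^sup>2 + 4)" by (subst real_sqrt_less_iff) simp
  then have "\<bar>r\<bar> < sqrt (r\<^sup>2 + 4)" by simp
  then show ?thesis unfolding minus_root_def by (simp add: abs_if split: if_splits)
qed

lemma sum_roots: "plus_root r + minus_root r = r"
  by (simp add: plus_root_def minus_root_def field_simps)

lemma prod_roots: "plus_root r * minus_root r = -1"
proof -
  have "(r + sqrt (r\<^sup>2 + 4)) * (r - sqrt (r\<^sup>2 + 4)) = r\<^sup>2 - (sqrt (r\<^sup>2 + 4))\<^sup>2"
    by (simp add: power2_eq_square algebra_simps)
  also have "\<dots> = -4" by (simp add: real_sqrt_pow2)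
  finally show ?thesis by (simp add: plus_root_def minus_root_def)
qed

lemma boole_eq_iff:
  assumes "x \<noteq> 0"
  shows "boole x = r \<longleftrightarrow> x = plus_root r \<or> x = minus_root r"
proof -
  have "boole x = r \<longleftrightarrow> x\<^sup>2 - r * x - 1 = 0"
    using assms by (auto simp: boole_def field_simps power2_eq_square)
  also have "x\<^sup>2 - r * x - 1 = (x - plus_root r) * (x - minus_root r)"
  proof -
    have "(x - plus_root r) * (x - minus_root r)
        = x\<^sup>2 - (plus_root r + minus_root r) * x + plus_root r * minus_root r"
      by (simp add: power2_eq_square algebra_simps)
    then show ?thesis by (simp add: sum_roots prod_roots)
  qed
  finally show ?thesis by simp
qed

lemma boole_roots [simp]: "boole (plus_root r) = r" "boole (minus_root r) = r"
  using boole_eq_iff[of "plus_root r" r] boole_eq_iff[of "minus_root r" r]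
    plus_root_pos[of r] minus_root_neg[of r] by auto

text \<open>
  The convention \<open>A\<^sub>0 = {0}\<close> makes the recursion valid from \<open>n = 0\<close>, since \<open>\<plusminus>1\<close> are
  the solutions of \<open>x - 1 / x = 0\<close>.
\<close>

lemma A_Suc: "A (Suc n) = plus_root ` A n \<union> minus_root ` A n"
  by (cases n) (auto simp: plus_root_def minus_root_def)

text \<open>
  The condition \<open>x \<noteq> 0\<close> excludes the spurious solution caused by \<open>1 / 0 = 0\<close>, which makes
  \<open>0\<close> a fixed point of the Boole map.
\<close>

lemma A_Suc_preimage: "A (Suc n) = {x. x \<noteq> 0 \<and> boole x \<in> A n}"
proof (intro set_eqI iffI)
  fix x assume "x \<in> A (Suc n)"
  then show "x \<in> {x. x \<noteq> 0 \<and> boole x \<in> A n}"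
    by (auto simp: A_Suc plus_root_pos minus_root_neg less_imp_neq[OF minus_root_neg]
        less_imp_neq[OF plus_root_pos, symmetric] simp del: A.simps)
next
  fix x assume "x \<in> {x. x \<noteq> 0 \<and> boole x \<in> A n}"
  then show "x \<in> A (Suc n)"
    using boole_eq_iff[of x "boole x"] by (auto simp: A_Suc simp del: A.simps)
qed

lemma finite_A: "finite (A n)"
  by (induction n) (auto simp: A_Suc simp del: A.simps(2,3))

lemma A_nonempty: "A n \<noteq> {}"
  by (induction n) (auto simp: A_Suc simp del: A.simps(2,3))

text \<open>
  Every element of \<open>A\<^sub>n\<^sub>+\<^sub>1\<close> arises only once: its sign tells which of the two roots it is,
  and its image under the Boole map recovers \<open>r\<close>.
\<close>

lemma sum_A_Suc:
  fixes h :: "real \<Rightarrow> real"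
  shows "(\<Sum>x\<in>A (Suc n). h x) = (\<Sum>r\<in>A n. h (plus_root r) + h (minus_root r))"
proof -
  have "inj_on plus_root (A n)" "inj_on minus_root (A n)"
    by (metis boole_roots inj_onI)+
  moreover have "plus_root ` A n \<inter> minus_root ` A n = {}"
    using plus_root_pos minus_root_neg by (smt (verit, best) disjoint_iff imageE)
  ultimately show ?thesis
    by (simp add: A_Suc sum.union_disjoint finite_A sum.reindex sum.distrib del: A.simps)
qed

lemma boole_orbit_A:
  assumes "x \<in> A n"
  shows "i < n \<Longrightarrow> (boole ^^ i) x \<noteq> 0" and "(boole ^^ n) x = 0"
proof -
  have "(i < n \<longrightarrow> (boole ^^ i) x \<noteq> 0) \<and> (boole ^^ n) x = 0" for i
    using assms
  proof (induction n arbitrary: x i)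
    case 0
    then show ?case by simp
  next
    case (Suc n)
    then have x: "x \<noteq> 0" "boole x \<in> A n" by (auto simp: A_Suc_preimage simp del: A.simps)
    show ?case using Suc.IH[OF x(2), of "i - 1"] x(1)
      by (cases i) (auto simp: funpow_swap1 simp del: funpow.simps simp add: funpow_Suc_right)
  qed
  then show "i < n \<Longrightarrow> (boole ^^ i) x \<noteq> 0" and "(boole ^^ n) x = 0" by blast+
qed

text \<open>
  The telescoping sum behind the eigenvalue equation: \<open>1 / y = y - boole y\<close> for every \<open>y\<close>.
\<close>

lemma sum_inverse_boole_orbit:
  assumes "k \<ge> 1"
  shows "(\<Sum>i=1..<k. 1 / (boole ^^ (i - 1)) x) = x - (boole ^^ (k - 1)) x"
  using assms
proof (induction k rule: nat_induct_at_least)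
  case base
  then show ?case by simp
next
  case (Suc k)
  then obtain j where "k = Suc j" by (cases k) auto
  with Suc show ?case by (simp add: boole_def)
qed

section \<open>Weights of the atoms\<close>

text \<open>
  The factor \<open>x\<^sup>2 / (1 + x\<^sup>2)\<close> is the reciprocal of the derivative \<open>1 + 1 / x\<^sup>2\<close> of the
  Boole map. Thus the weight of \<open>x\<close> is the residue at \<open>x\<close> of the reciprocal of the
  \<open>n\<close>-fold iterate, which is the Cauchy transform of the vacuum distribution.
\<close>

fun weight :: "nat \<Rightarrow> real \<Rightarrow> real" where
  "weight 0 x = 1"
| "weight (Suc n) x = x\<^sup>2 / (1 + x\<^sup>2) * weight n (boole x)"

lemma weight_pos: "x \<in> A n \<Longrightarrow> weight n x > 0"
proof (induction n arbitrary: x)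
  case 0
  then show ?case by simp
next
  case (Suc n)
  then have x: "x \<noteq> 0" "boole x \<in> A n" by (auto simp: A_Suc_preimage simp del: A.simps)
  then show ?case using Suc.IH[of "boole x"]
    by (auto intro!: mult_pos_pos divide_pos_pos add_pos_nonneg)
qed

text \<open>
  The mass at \<open>r\<close> is split between its two preimages without loss, and in such a way that
  \<open>1 / x\<close> averages to zero over the pair. Both follow from \<open>m = - 1 / p\<close>, which turns the
  share \<open>m\<^sup>2 / (1 + m\<^sup>2)\<close> of \<open>m\<close> into \<open>1 / (1 + p\<^sup>2)\<close>.
\<close>

lemma root_weights:
  fixes r :: real
  defines "p \<equiv> plus_root r" and "m \<equiv> minus_root r"
  shows "p\<^sup>2 / (1 + p\<^sup>2) + m\<^sup>2 / (1 + m\<^sup>2) = 1"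
    and "p\<^sup>2 / (1 + p\<^sup>2) * (1 / p) + m\<^sup>2 / (1 + m\<^sup>2) * (1 / m) = 0"
proof -
  have p: "p > 0" using plus_root_pos p_def by simp
  have m: "m = - (1 / p)" using prod_roots[of r] p by (simp add: p_def m_def field_simps)
  have pos: "1 + p\<^sup>2 > 0" by (simp add: add_pos_nonneg)
  have "m\<^sup>2 / (1 + m\<^sup>2) = 1 / (1 + p\<^sup>2)"
    using p pos by (simp add: m field_simps)
  then show "p\<^sup>2 / (1 + p\<^sup>2) + m\<^sup>2 / (1 + m\<^sup>2) = 1"
    and "p\<^sup>2 / (1 + p\<^sup>2) * (1 / p) + m\<^sup>2 / (1 + m\<^sup>2) * (1 / m) = 0"
    using p pos by (simp_all add: m add_divide_distrib[symmetric] add.commute power2_eq_square)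
qed

text \<open>
  Grouping the atoms into pairs with the same image \<open>r\<close>, only the factor for \<open>i = 0\<close>
  distinguishes the members of a pair. If it is present, each pair cancels; otherwise each pair
  collapses to the term of \<open>r\<close> and the induction hypothesis applies.
\<close>

lemma weighted_sum_orbit_products:
  assumes "T \<subseteq> {..<n}"
  shows "(\<Sum>x\<in>A n. weight n x * (\<Prod>i\<in>T. 1 / (boole ^^ i) x)) = (if T = {} then 1 else 0)"
  using assms
proof (induction n arbitrary: T)
  case 0
  then show ?case by simp
next
  case (Suc n)
  \<comment> \<open>The positions along the orbit of \<open>boole x\<close>, which starts one step later.\<close>
  define T' where "T' = {i. Suc i \<in> T}"
  have T': "T' \<subseteq> {..<n}" using Suc.prems by (auto simp: T'_def)
  then have fin: "finite T'" using finite_subset by blast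
  have T: "T = (if 0 \<in> T then insert 0 (Suc ` T') else Suc ` T')"
  proof (rule set_eqI)
    fix i
    show "i \<in> T \<longleftrightarrow> i \<in> (if 0 \<in> T then insert 0 (Suc ` T') else Suc ` T')"
      by (cases i) (auto simp: T'_def)
  qed
  define e :: "real \<Rightarrow> real" where "e x = (if 0 \<in> T then 1 / x else 1)" for x
  have prod: "(\<Prod>i\<in>T. 1 / (boole ^^ i) x) = e x * (\<Prod>i\<in>T'. 1 / (boole ^^ i) (boole x))" for x
  proof -
    have "(\<Prod>i\<in>Suc ` T'. 1 / (boole ^^ i) x) = (\<Prod>i\<in>T'. 1 / (boole ^^ i) (boole x))"
      by (simp add: prod.reindex funpow_Suc_right del: funpow.simps)
    moreover have "0 \<notin> Suc ` T'" by auto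
    ultimately show ?thesis
      using fin by (subst T) (simp add: e_def)
  qed
  have e: "(plus_root r)\<^sup>2 / (1 + (plus_root r)\<^sup>2) * e (plus_root r)
         + (minus_root r)\<^sup>2 / (1 + (minus_root r)\<^sup>2) * e (minus_root r)
         = (if 0 \<in> T then 0 else 1)" for r
    using root_weights[of r] by (cases "0 \<in> T") (simp_all only: e_def if_True if_False mult_1_right)
  have "(\<Sum>x\<in>A (Suc n). weight (Suc n) x * (\<Prod>i\<in>T. 1 / (boole ^^ i) x))
      = (\<Sum>r\<in>A n. (if 0 \<in> T then 0 else 1) * (weight n r * (\<Prod>i\<in>T'. 1 / (boole ^^ i) r)))"
    unfolding sum_A_Suc
  proof (intro sum.cong refl)
    fix r
    let ?p = "plus_root r" and ?m = "minus_root r"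
    let ?R = "weight n r * (\<Prod>i\<in>T'. 1 / (boole ^^ i) r)"
    have "weight (Suc n) ?p * (\<Prod>i\<in>T. 1 / (boole ^^ i) ?p)
        + weight (Suc n) ?m * (\<Prod>i\<in>T. 1 / (boole ^^ i) ?m)
        = (?p\<^sup>2 / (1 + ?p\<^sup>2) * e ?p + ?m\<^sup>2 / (1 + ?m\<^sup>2) * e ?m) * ?R"
      unfolding prod weight.simps boole_roots by (simp only: ring_distribs mult_ac)
    then show "weight (Suc n) ?p * (\<Prod>i\<in>T. 1 / (boole ^^ i) ?p)
        + weight (Suc n) ?m * (\<Prod>i\<in>T. 1 / (boole ^^ i) ?m)
        = (if 0 \<in> T then 0 else 1) * ?R"
      unfolding e .
  qed
  also have "\<dots> = (if 0 \<in> T then 0 else 1) * (if T' = {} then 1 else 0)"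
    by (simp add: sum_distrib_left[symmetric] Suc.IH[OF T'] del: A.simps)
  also have "\<dots> = (if T = {} then 1 else 0)"
  proof -
    have "T = {}" if "0 \<notin> T" "T' = {}"
      using that by (subst T) simp
    then show ?thesis by (auto simp: T'_def)
  qed
  finally show ?case .
qed

section \<open>Creation and annihilation in coordinates\<close>

lemma mono_index_Nil [simp]: "[] \<in> mono_index"
  by (simp add: mono_index_def)

lemma mono_index_Cons:
  "i # s \<in> mono_index \<longleftrightarrow> 1 \<le> i \<and> (s = [] \<or> i < hd s) \<and> s \<in> mono_index"
  by (cases s) (auto simp: mono_index_def)

lemma infsum_single:
  fixes f :: "'a \<Rightarrow> complex"
  assumes "\<And>s. s \<in> S \<Longrightarrow> s \<noteq> a \<Longrightarrow> f s = 0"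
  shows "(\<Sum>\<^sub>\<infinity>s\<in>S. f s) = (if a \<in> S then f a else 0)"
proof -
  have "(\<Sum>\<^sub>\<infinity>s\<in>S. f s) = (\<Sum>\<^sub>\<infinity>s\<in>S \<inter> {a}. f s)"
    by (rule infsum_cong_neutral) (use assms in auto)
  then show ?thesis by (cases "a \<in> S") auto
qed

lemma fock_inner_vacuum: "fock_inner f vacuum = f []"
  unfolding fock_inner_def vacuum_def
  by (subst infsum_single[where a = "[]"]) (auto simp: basis_vec_def)

lemma fock_inner_basis_vec:
  "s \<in> mono_index \<Longrightarrow> fock_inner (basis_vec s) h = cnj (h s)"
  unfolding fock_inner_def
  by (subst infsum_single[where a = s]) (auto simp: basis_vec_def)

lemma finite_support_mono_fock:
  assumes "finite S" "S \<subseteq> mono_index" "\<And>s. s \<notin> S \<Longrightarrow> f s = 0"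
  shows "f \<in> mono_fock"
proof -
  have "(\<lambda>s. (cmod (f s))\<^sup>2) summable_on mono_index \<longleftrightarrow> (\<lambda>s. (cmod (f s))\<^sup>2) summable_on S"
    by (rule summable_on_cong_neutral) (use assms in auto)
  then show ?thesis using assms by (auto simp: mono_fock_def)
qed

lemma basis_vec_mono_fock: "s \<in> mono_index \<Longrightarrow> basis_vec s \<in> mono_fock"
  by (rule finite_support_mono_fock[of "{s}"]) (auto simp: basis_vec_def)

lemma creation_apply:
  assumes "i \<ge> 1"
  shows "creation i f t = (if t \<in> mono_index \<and> t \<noteq> [] \<and> hd t = i then f (tl t) else 0)"
  unfolding creation_def using assms
  by (subst infsum_single[where a = "tl t"]; cases t)
     (auto simp: creation_on_basis_def basis_vec_def mono_index_Cons)

text \<open>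
  The adjoint only has to be identified: deleting the head \<open>i\<close> is a bijection from the lists in
  the image of the creation operator to those on which it does not vanish, so re-indexing the
  inner product along
  it yields the adjoint relation. Pairing with the basis vectors shows that no other vector
  satisfies it.
\<close>

lemma annihilation_apply:
  assumes i: "i \<ge> 1" and g: "g \<in> mono_fock"
  shows "annihilation i g = (\<lambda>s. g (i # s))"
proof -
  let ?h = "\<lambda>s. g (i # s)"
  have g0: "g s = 0" if "s \<notin> mono_index" for s
    using g that by (auto simp: mono_fock_def)
  let ?D = "{s. i # s \<in> mono_index}"
  have D: "?D \<subseteq> mono_index" "Cons i ` ?D \<subseteq> mono_index"
    by (auto simp: mono_index_Cons)
  have "(\<lambda>s. (cmod (g s))\<^sup>2) summable_on Cons i ` ?D"
    using g D(2) by (auto simp: mono_fock_def intro: summable_on_subset_banach)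
  then have "(\<lambda>s. (cmod (?h s))\<^sup>2) summable_on ?D"
    by (subst (asm) summable_on_reindex) (auto simp: o_def)
  also have "?this \<longleftrightarrow> (\<lambda>s. (cmod (?h s))\<^sup>2) summable_on mono_index"
    by (rule summable_on_cong_neutral) (use D g0 in auto)
  finally have h: "?h \<in> mono_fock"
    by (auto simp: mono_fock_def mono_index_Cons intro!: g0)
  have adj: "fock_inner (creation i f) g = fock_inner f ?h" for f
  proof -
    have "fock_inner (creation i f) g = (\<Sum>\<^sub>\<infinity>t\<in>Cons i ` ?D. f (tl t) * cnj (g t))"
      unfolding fock_inner_def
      by (rule infsum_cong_neutral)
         (use i in \<open>auto simp: creation_apply mono_index_Cons image_iff neq_Nil_conv\<close>)
    also have "\<dots> = (\<Sum>\<^sub>\<infinity>s\<in>?D. f s * cnj (?h s))"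
      by (subst infsum_reindex) (auto simp: o_def)
    also have "\<dots> = fock_inner f ?h"
      unfolding fock_inner_def
      by (rule infsum_cong_neutral) (use D g0 in auto)
    finally show ?thesis .
  qed
  show ?thesis unfolding annihilation_def fock_adjoint_def
  proof (rule the_equality)
    show "?h \<in> mono_fock \<and> (\<forall>f\<in>mono_fock. fock_inner (creation i f) g = fock_inner f ?h)"
      using h adj by blast
  next
    fix k
    assume k: "k \<in> mono_fock \<and> (\<forall>f\<in>mono_fock. fock_inner (creation i f) g = fock_inner f k)"
    show "k = ?h"
    proof
      fix s
      show "k s = ?h s"
      proof (cases "s \<in> mono_index")
        case True
        then have "fock_inner (basis_vec s) k = fock_inner (basis_vec s) ?h"
          using k adj basis_vec_mono_fock by metis
        then show ?thesis using True by (simp add: fock_inner_basis_vec)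
      next
        case False
        then show ?thesis using k h by (auto simp: mono_fock_def)
      qed
    qed
  qed
qed

text \<open>
  Of the creation operators only the one for \<open>i = hd t\<close> reaches the coordinate \<open>t\<close>.
  The annihilators effectively run over \<open>i < hd t\<close> only, because \<open>g\<close> vanishes at lists that are not
  strictly increasing.
\<close>

lemma position_sum_apply:
  assumes "g \<in> mono_fock"
  shows "position_sum n g t = (\<Sum>i=1..n. g (i # t)) +
           (if t \<in> mono_index \<and> t \<noteq> [] \<and> hd t \<le> n then g (tl t) else 0)"
proof -
  have "position_sum n g t = (\<Sum>i=1..n. g (i # t) +
      (if t \<in> mono_index \<and> t \<noteq> [] \<and> hd t = i then g (tl t) else 0))"
    unfolding position_sum_def
    by (intro sum.cong refl) (simp add: annihilation_apply[OF _ assms] creation_apply)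
  also have "\<dots> = (\<Sum>i=1..n. g (i # t)) +
      (\<Sum>i=1..n. if i = hd t then (if t \<in> mono_index \<and> t \<noteq> [] then g (tl t) else 0) else 0)"
    unfolding sum.distrib[symmetric] by (intro sum.cong refl) auto
  also have "(\<Sum>i=1..n. if i = hd t then (if t \<in> mono_index \<and> t \<noteq> [] then g (tl t) else 0) else 0)
     = (if t \<in> mono_index \<and> t \<noteq> [] \<and> hd t \<le> n then g (tl t) else 0)"
    by (cases t) (auto simp: mono_index_Cons)
  finally show ?thesis .
qed

section \<open>Spectral decomposition of the vacuum\<close>

definition index_upto :: "nat \<Rightarrow> nat list set" where
  "index_upto n = {s \<in> mono_index. set s \<subseteq> {1..n}}"

lemma index_upto_Cons:
  "i # s \<in> index_upto n \<longleftrightarrow> 1 \<le> i \<and> i \<le> n \<and> (s = [] \<or> i < hd s) \<and> s \<in> index_upto n"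
  by (auto simp: index_upto_def mono_index_Cons)

lemma index_upto_subset: "index_upto n \<subseteq> mono_index"
  by (auto simp: index_upto_def)

lemma finite_index_upto: "finite (index_upto n)"
proof -
  have "index_upto n \<subseteq> {s. set s \<subseteq> {1..n} \<and> distinct s}"
    by (auto simp: index_upto_def mono_index_def strict_sorted_iff)
  then show ?thesis
    using finite_subset finite_subset_distinct[of "{1..n}"] by blast
qed

text \<open>
  For \<open>x \<in> A\<^sub>n\<close>, the orthogonal projection of the vacuum onto the eigenspace of \<open>x\<close>.
  Particle labels start
  at \<open>1\<close>, iterates at \<open>0\<close>, whence the exponent \<open>i - 1\<close>.
\<close>

definition spectral_component :: "nat \<Rightarrow> real \<Rightarrow> nat list \<Rightarrow> complex" where
  "spectral_component n x s =
     (if s \<in> index_upto n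
      then complex_of_real (weight n x * (\<Prod>i\<in>set s. 1 / (boole ^^ (i - 1)) x)) else 0)"

lemma spectral_component_Cons:
  assumes "i # s \<in> index_upto n"
  shows "spectral_component n x (i # s) = spectral_component n x s / (boole ^^ (i - 1)) x"
proof -
  have "i \<notin> set s" "s \<in> index_upto n"
    using assms by (auto simp: index_upto_def mono_index_def)
  then show ?thesis using assms by (simp add: spectral_component_def)
qed

lemma combination_mono_fock:
  "(\<lambda>s. \<Sum>x\<in>X. c x * spectral_component n x s) \<in> mono_fock"
  by (rule finite_support_mono_fock[OF finite_index_upto[of n]])
     (simp_all add: index_upto_subset spectral_component_def)

lemma spectral_component_eigenvector:
  assumes x: "x \<in> A n"
  shows "position_sum n (spectral_component n x) t = x * spectral_component n x t"
proof -
  let ?v = "spectral_component n x"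
  let ?b = "\<lambda>i. complex_of_real ((boole ^^ (i - 1)) x)"
  have tele: "(\<Sum>i=1..<k. 1 / ?b i) = x - ?b k" if "k \<ge> 1" for k
  proof -
    have "(\<Sum>i=1..<k. 1 / ?b i) = complex_of_real (\<Sum>i=1..<k. 1 / (boole ^^ (i - 1)) x)"
      by simp
    then show ?thesis by (simp only: sum_inverse_boole_orbit[OF that] of_real_diff)
  qed
  have "?v \<in> mono_fock"
    using combination_mono_fock[where X = "{x}" and c = "\<lambda>_. 1" and n = n] by simp
  note pos = position_sum_apply[OF this]
  show ?thesis
  proof (cases "t \<in> index_upto n")
    case False
    then have "i # t \<notin> index_upto n" for i by (auto simp: index_upto_Cons)
    moreover have "tl t \<notin> index_upto n" if "t \<in> mono_index" "t \<noteq> []" "hd t \<le> n"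
      using that False by (cases t) (auto simp: index_upto_Cons mono_index_Cons)
    ultimately show ?thesis using False by (simp add: pos spectral_component_def)
  next
    case t: True
    show ?thesis
    proof (cases t)
      case Nil
      \<comment> \<open>The telescoping sum runs along the whole orbit, which ends at \<open>0\<close>.\<close>
      have "(\<Sum>i=1..n. ?v (i # t)) = (\<Sum>i=1..<Suc n. ?v t * (1 / ?b i))"
        using t Nil by (intro sum.cong) (auto simp: spectral_component_Cons index_upto_Cons)
      also have "\<dots> = ?v t * (x - ?b (Suc n))"
        unfolding sum_distrib_left[symmetric] by (subst tele) auto
      finally show ?thesis using Nil boole_orbit_A(2)[OF x] by (simp add: pos)
    next
      case (Cons k u)
      \<comment> \<open>The annihilators stop just before \<open>k\<close>; creating \<open>k\<close> supplies exactly the missing \<open>x\<^sub>k\<close>.\<close>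
      then have k: "1 \<le> k" "k \<le> n" and u: "u \<in> index_upto n"
        using t by (simp_all add: index_upto_Cons)
      have tm: "t \<in> mono_index" using t index_upto_subset by blast
      have "(\<Sum>i=1..n. ?v (i # t)) = (\<Sum>i=1..<k. ?v t * (1 / ?b i))"
      proof (rule sum.mono_neutral_cong_right)
        show "\<forall>i\<in>{1..n} - {1..<k}. ?v (i # t) = 0"
          using Cons by (auto simp: spectral_component_def index_upto_Cons)
        show "?v (i # t) = ?v t * (1 / ?b i)" if "i \<in> {1..<k}" for i
          using that k t Cons by (subst spectral_component_Cons) (auto simp: index_upto_Cons)
      qed (use k in auto)
      also have "\<dots> = ?v t * (x - ?b k)"
        unfolding sum_distrib_left[symmetric] by (subst tele) (use k in auto)
      finally have 1: "(\<Sum>i=1..n. ?v (i # t)) = ?v t * (x - ?b k)" .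
      have "(boole ^^ (k - 1)) x \<noteq> 0" using boole_orbit_A(1)[OF x] k by simp
      then have "?v u = ?v t * ?b k"
        using spectral_component_Cons t Cons by simp
      with 1 show ?thesis using Cons k tm by (simp add: pos algebra_simps)
    qed
  qed
qed

lemma vacuum_spectral_decomposition:
  "vacuum = (\<lambda>s. \<Sum>x\<in>A n. spectral_component n x s)"
proof
  fix s
  show "vacuum s = (\<Sum>x\<in>A n. spectral_component n x s)"
  proof (cases "s \<in> index_upto n")
    case False
    then have "s \<noteq> []" by (auto simp: index_upto_def)
    with False show ?thesis by (simp add: spectral_component_def vacuum_def basis_vec_def)
  next
    case True
    let ?T = "(\<lambda>i. i - 1) ` set s"
    have "\<forall>i\<in>set s. 1 \<le> i" using True by (simp add: index_upto_def mono_index_def)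
    then have inj: "inj_on (\<lambda>i. i - 1) (set s)"
      by (intro inj_onI) (metis le_add_diff_inverse)
    have "?T \<subseteq> {..<n}" using True by (force simp: index_upto_def)
    then have "(\<Sum>x\<in>A n. weight n x * (\<Prod>i\<in>?T. 1 / (boole ^^ i) x)) = (if s = [] then 1 else 0)"
      using weighted_sum_orbit_products[of ?T n] by simp
    then have "(\<Sum>x\<in>A n. weight n x * (\<Prod>i\<in>set s. 1 / (boole ^^ (i - 1)) x))
        = (if s = [] then 1 else 0)"
      by (simp only: prod.reindex[OF inj] o_def)
    moreover have "(\<Sum>x\<in>A n. spectral_component n x s) =
        complex_of_real (\<Sum>x\<in>A n. weight n x * (\<Prod>i\<in>set s. 1 / (boole ^^ (i - 1)) x))"
      using True by (simp add: spectral_component_def)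
    ultimately have "(\<Sum>x\<in>A n. spectral_component n x s) =
        complex_of_real (if s = [] then 1 else 0)"
      by (simp only:)
    then show ?thesis by (simp add: vacuum_def basis_vec_def)
  qed
qed

lemma position_sum_power_vacuum:
  "(position_sum n ^^ p) vacuum = (\<lambda>s. \<Sum>x\<in>A n. of_real (x ^ p) * spectral_component n x s)"
proof (induction p)
  case 0
  show ?case by (simp add: vacuum_spectral_decomposition[of n])
next
  case (Suc p)
  let ?v = "spectral_component n"
  have v: "?v x \<in> mono_fock" for x
    using combination_mono_fock[where X = "{x}" and c = "\<lambda>_. 1" and n = n] by simp
  have "position_sum n (\<lambda>s. \<Sum>x\<in>A n. of_real (x ^ p) * ?v x s) t
      = (\<Sum>x\<in>A n. of_real (x ^ p) * position_sum n (?v x) t)" for t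
  proof -
    have "(\<Sum>i=1..n. \<Sum>x\<in>A n. of_real (x ^ p) * ?v x (i # t))
        = (\<Sum>x\<in>A n. of_real (x ^ p) * (\<Sum>i=1..n. ?v x (i # t)))"
      by (subst sum.swap) (simp only: sum_distrib_left)
    then show ?thesis
      unfolding position_sum_apply[OF combination_mono_fock] position_sum_apply[OF v]
      by (cases "t \<in> mono_index \<and> t \<noteq> [] \<and> hd t \<le> n")
        (simp_all only: distrib_left sum.distrib if_True if_False mult_zero_right
          sum.neutral_const simp_thms)
  qed
  also have "(\<Sum>x\<in>A n. of_real (x ^ p) * position_sum n (?v x) t)
      = (\<Sum>x\<in>A n. of_real (x ^ Suc p) * ?v x t)" for t
    by (intro sum.cong refl) (simp add: spectral_component_eigenvector)
  finally show ?case by (simp add: Suc.IH)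
qed

lemma vacuum_moment:
  "fock_inner ((position_sum n ^^ p) vacuum) vacuum
     = complex_of_real (\<Sum>x\<in>A n. weight n x * x ^ p)"
  by (simp add: fock_inner_vacuum position_sum_power_vacuum spectral_component_def
      index_upto_def mult.commute)

section \<open>Measures with finite support are determined by their moments\<close>

lemma poly_interpolation_exists:
  fixes f :: "'a::field \<Rightarrow> 'a"
  assumes "finite S"
  shows "\<exists>q. \<forall>a\<in>S. poly q a = f a"
  using assms
proof (induction S rule: finite_induct)
  case empty
  then show ?case by simp
next
  case (insert a S)
  then obtain q where q: "\<forall>b\<in>S. poly q b = f b" by blast
  define P where "P = (\<Prod>b\<in>S. [:-b, 1:])"
  have P0: "poly P b = 0" if "b \<in> S" for b
    using that insert.hyps by (auto simp: P_def poly_prod)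
  have Pa: "poly P a \<noteq> 0"
    using insert.hyps by (auto simp: P_def poly_prod)
  have "\<forall>b\<in>insert a S. poly (q + smult ((f a - poly q a) / poly P a) P) b = f b"
    using q P0 Pa by auto
  then show ?case by blast
qed

text \<open>
  All integrals of polynomials agree. The square of the polynomial vanishing exactly on the support
  of \<open>p\<close> has integral zero, so \<open>\<mu>\<close> is concentrated on that finite set. There every
  indicator function coincides with an interpolation polynomial, so the measures of all Borel sets
  agree as well.
\<close>

lemma finite_support_measure_determinate:
  fixes p :: "real pmf" and \<mu> :: "real measure"
  assumes fin: "finite (set_pmf p)" and \<mu>: "prob_space \<mu>" "sets \<mu> = sets borel"
    and int: "\<And>k::nat. integrable \<mu> (\<lambda>x. x ^ k)"
    and mom: "\<And>k::nat. (\<integral>x. x ^ k \<partial>\<mu>) = measure_pmf.expectation p (\<lambda>x. x ^ k)"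
  shows "\<mu> = distr (measure_pmf p) borel (\<lambda>x. x)"
proof -
  interpret prob_space \<mu> by fact
  have intp: "integrable (measure_pmf p) f" for f :: "real \<Rightarrow> real"
    by (rule integrable_measure_pmf_finite[OF fin])
  have poly: "integrable \<mu> (poly q)"
    "(\<integral>x. poly q x \<partial>\<mu>) = measure_pmf.expectation p (poly q)" for q
  proof -
    have q: "poly q = (\<lambda>x. \<Sum>i\<le>degree q. coeff q i * x ^ i)"
      by (simp add: fun_eq_iff poly_altdef)
    show "integrable \<mu> (poly q)" unfolding q by (simp add: int)
    show "(\<integral>x. poly q x \<partial>\<mu>) = measure_pmf.expectation p (poly q)"
      unfolding q by (simp add: int intp mom)
  qed
  define Q where "Q = (\<Prod>a\<in>set_pmf p. [:-a, 1:])"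
  have Q: "poly Q x = 0 \<longleftrightarrow> x \<in> set_pmf p" for x
    using fin by (auto simp: Q_def poly_prod)
  have "(\<integral>x. poly (Q * Q) x \<partial>\<mu>) = 0"
    unfolding poly(2) by (rule integral_eq_zero_AE) (auto simp: AE_measure_pmf_iff Q)
  moreover have "AE x in \<mu>. 0 \<le> poly (Q * Q) x" by simp
  ultimately have "AE x in \<mu>. poly (Q * Q) x = 0"
    using integral_nonneg_eq_0_iff_AE[OF poly(1)[of "Q * Q"]] by blast
  then have ae: "AE x in \<mu>. x \<in> set_pmf p" by (simp add: Q)
  show ?thesis
  proof (rule measure_eqI)
    show "sets \<mu> = sets (distr (measure_pmf p) borel (\<lambda>x. x))" using \<mu> by simp
  next
    fix B assume B: "B \<in> sets \<mu>"
    obtain q where q: "\<forall>a\<in>set_pmf p. poly q a = indicator B a"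
      using poly_interpolation_exists[OF fin] by blast
    have "prob B = (\<integral>x. indicator B x \<partial>\<mu>)" using B by simp
    also have "\<dots> = (\<integral>x. poly q x \<partial>\<mu>)"
      using ae q B poly(1)[of q] by (intro integral_cong_AE) auto
    also have "\<dots> = measure_pmf.expectation p (indicator B)"
      unfolding poly(2) using q by (intro integral_cong_AE) (auto simp: AE_measure_pmf_iff)
    also have "\<dots> = measure (measure_pmf p) B" by simp
    finally show "emeasure \<mu> B = emeasure (distr (measure_pmf p) borel (\<lambda>x. x)) B"
      using B \<mu> by (simp add: emeasure_distr emeasure_eq_measure measure_pmf.emeasure_eq_measure)
  qed
qed

lemma sum_weight: "(\<Sum>x\<in>A n. weight n x) = 1"
  using weighted_sum_orbit_products[of "{}" n] by simp

lemma atoms_vacuum_distribution: "atoms (vacuum_distribution n) = A n"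
proof -
  define w where "w x = (if x \<in> A n then weight n x else 0)" for x
  define p where "p = embed_pmf w"
  have w0: "w x \<ge> 0" for x using weight_pos by (auto simp: w_def intro: less_imp_le)
  have "(\<integral>\<^sup>+ x. ennreal (w x) \<partial>count_space UNIV) = (\<Sum>x\<in>A n. ennreal (w x))"
    by (rule nn_integral_count_space') (auto simp: finite_A w_def)
  also have "\<dots> = ennreal (\<Sum>x\<in>A n. w x)" by (simp add: w0)
  also have "\<dots> = 1" by (simp add: w_def sum_weight)
  finally have pmf: "pmf p x = w x" for x
    unfolding p_def by (intro pmf_embed_pmf w0)
  have set: "set_pmf p = A n"
    using weight_pos[of _ n] by (auto simp: set_pmf_iff pmf w_def less_le split: if_splits)
  then have fin: "finite (set_pmf p)" by (simp add: finite_A)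
  have mom: "measure_pmf.expectation p (\<lambda>x. x ^ k) = (\<Sum>x\<in>A n. weight n x * x ^ k)" for k
    by (subst integral_measure_pmf[of "A n"]) (auto simp: finite_A set pmf w_def)
  let ?\<nu> = "distr (measure_pmf p) borel (\<lambda>x. x)"
  have "vacuum_distribution n = ?\<nu>"
    unfolding vacuum_distribution_def
  proof (rule the_equality)
    show "prob_space ?\<nu> \<and> sets ?\<nu> = sets borel \<and>
        (\<forall>k::nat. integrable ?\<nu> (\<lambda>x. x ^ k) \<and>
           complex_of_real (\<integral>x. x ^ k \<partial>?\<nu>) = fock_inner ((position_sum n ^^ k) vacuum) vacuum)"
      by (auto simp: measure_pmf.prob_space_distr integrable_distr_eq integral_distr
          integrable_measure_pmf_finite[OF fin] mom vacuum_moment simp del: of_real_sum)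
  next
    fix \<mu> :: "real measure"
    assume "prob_space \<mu> \<and> sets \<mu> = sets borel \<and>
        (\<forall>k::nat. integrable \<mu> (\<lambda>x. x ^ k) \<and>
           complex_of_real (\<integral>x. x ^ k \<partial>\<mu>) = fock_inner ((position_sum n ^^ k) vacuum) vacuum)"
    then show "\<mu> = ?\<nu>"
      by (intro finite_support_measure_determinate[OF fin])
         (auto simp: mom vacuum_moment simp del: of_real_sum)
  qed
  moreover have "measure ?\<nu> {x} = w x" for x
    by (simp add: measure_distr pmf[symmetric] pmf.rep_eq)
  ultimately show ?thesis using weight_pos by (auto simp: atoms_def w_def)
qed

section \<open>The largest atom\<close>

text \<open>
  The positive root inverts the Boole map, which is increasing on the positive half-line.
\<close>

lemma plus_root_mono: "r \<le> s \<Longrightarrow> plus_root r \<le> plus_root s"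
proof (rule ccontr)
  assume rs: "r \<le> s" and "\<not> plus_root r \<le> plus_root s"
  then have less: "plus_root s < plus_root r" by simp
  then have "1 / plus_root r < 1 / plus_root s"
    using plus_root_pos[of s] by (simp add: frac_less2)
  with less have "boole (plus_root s) < boole (plus_root r)" by (simp add: boole_def)
  with rs show False by simp
qed

lemma Max_A_Suc: "Max (A (Suc n)) = plus_root (Max (A n))"
proof (rule Max_eqI)
  show "finite (A (Suc n))" by (rule finite_A)
  show "plus_root (Max (A n)) \<in> A (Suc n)"
    using Max_in[OF finite_A A_nonempty] by (simp add: A_Suc)
  fix y assume "y \<in> A (Suc n)"
  then consider r where "r \<in> A n" "y = plus_root r" | r where "r \<in> A n" "y = minus_root r"
    by (auto simp: A_Suc simp del: A.simps)
  then show "y \<le> plus_root (Max (A n))"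
  proof cases
    case 1
    then show ?thesis by (simp add: plus_root_mono finite_A)
  next
    case 2
    then show ?thesis using minus_root_neg plus_root_pos by (meson less_trans less_imp_le)
  qed
qed

lemma plus_root_square: "(plus_root r)\<^sup>2 = r\<^sup>2 + 2 - 1 / (plus_root r)\<^sup>2"
proof -
  have "r = plus_root r - 1 / plus_root r"
    using boole_roots(1)[of r] by (simp add: boole_def)
  then have "r\<^sup>2 = (plus_root r - 1 / plus_root r)\<^sup>2" by simp
  also have "\<dots> = (plus_root r)\<^sup>2 - 2 + 1 / (plus_root r)\<^sup>2"
    using plus_root_pos[of r] by (simp add: power2_eq_square field_simps)
  finally show ?thesis by simp
qed

lemma plus_root_ge_1: "r \<ge> 0 \<Longrightarrow> plus_root r \<ge> 1"
  using plus_root_mono[of 0 r] by (simp add: plus_root_def)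

lemma Max_A_nonneg: "Max (A n) \<ge> 0"
  by (induction n) (auto simp: Max_A_Suc plus_root_pos less_imp_le simp del: A.simps(2,3))

text \<open>
  The correction \<open>1 / R\<^sup>2\<close> is at most \<open>1\<close>, so each step adds at least \<open>1\<close>.
\<close>

lemma Max_A_square_ge: "(Max (A n))\<^sup>2 \<ge> real n"
proof (induction n)
  case 0
  then show ?case by simp
next
  case (Suc n)
  have "1 / (plus_root (Max (A n)))\<^sup>2 \<le> 1"
    using plus_root_ge_1[OF Max_A_nonneg[of n]] by simp
  then show ?case
    using Suc plus_root_square[of "Max (A n)"] by (simp add: Max_A_Suc del: A.simps)
qed

lemma Max_A_square_less: "n \<ge> 1 \<Longrightarrow> (Max (A n))\<^sup>2 < 2 * real n"
proof (induction n rule: nat_induct_at_least)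
  case base
  then show ?case by simp
next
  case (Suc n)
  define c where "c = 1 / (plus_root (Max (A n)))\<^sup>2"
  have "c > 0"
    using plus_root_pos[of "Max (A n)"] by (simp add: c_def)
  moreover have "(Max (A (Suc n)))\<^sup>2 = (Max (A n))\<^sup>2 + 2 - c"
    unfolding Max_A_Suc c_def by (rule plus_root_square)
  ultimately show ?case using Suc.IH by simp
qed

text \<open>
  The step needs \<open>1 / R\<^sub>n\<^sub>+\<^sub>1\<^sup>2 \<le> \<surd>(2n + 2) - \<surd>(2n)\<close>. The right-hand side equals
  \<open>2 / (\<surd>(2n + 2) + \<surd>(2n))\<close>, hence is at least \<open>1 / \<surd>(2n + 2)\<close>, and
  \<open>R\<^sub>n\<^sub>+\<^sub>1\<^sup>2 \<ge> n + 1 \<ge> \<surd>(2n + 2)\<close> for \<open>n \<ge> 1\<close>.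
\<close>

lemma Max_A_square_lower:
  "n \<ge> 1 \<Longrightarrow> (Max (A n))\<^sup>2 \<ge> 2 * real n - sqrt (2 * real n)"
proof (induction n rule: nat_induct_at_least)
  case base
  have "sqrt 2 \<ge> 1" by simp
  then show ?case by simp
next
  case (Suc n)
  let ?a = "sqrt (2 * real n)" and ?b = "sqrt (2 * real (Suc n))"
  have sq: "?a\<^sup>2 = 2 * real n" "?b\<^sup>2 = 2 * real (Suc n)" by simp_all
  have ab: "?a \<le> ?b" "?b > 0" "?a \<ge> 0" by simp_all
  have "?b\<^sup>2 \<le> (real (Suc n))\<^sup>2"
    unfolding sq unfolding power2_eq_square using Suc.hyps by (intro mult_right_mono) auto
  then have b: "?b \<le> real (Suc n)" by (rule power2_le_imp_le) simp
  have "2 = (?b - ?a) * (?b + ?a)"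
    using sq by (simp add: power2_eq_square algebra_simps)
  also have "\<dots> \<le> (?b - ?a) * (2 * ?b)" using ab by (intro mult_left_mono) auto
  finally have "1 / ?b \<le> ?b - ?a" using ab by (simp add: field_simps)
  moreover have "1 / (plus_root (Max (A n)))\<^sup>2 \<le> 1 / ?b"
    using Max_A_square_ge[of "Suc n"] b ab(2) unfolding Max_A_Suc
    by (intro frac_le) linarith+
  ultimately show ?case
    using Suc.IH plus_root_square[of "Max (A n)"] by (simp add: Max_A_Suc del: A.simps)
qed

theorem proposition3p2:
  fixes n :: nat
  assumes "n \<ge> 1"
  shows "A n = atoms (vacuum_distribution n) \<and>
         sqrt (2 * real n - sqrt (2 * real n)) \<le> Max (A n) \<and>
         Max (A n) < sqrt (2 * real n)"
proof (intro conjI)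
  show "A n = atoms (vacuum_distribution n)" by (simp add: atoms_vacuum_distribution)
  show "sqrt (2 * real n - sqrt (2 * real n)) \<le> Max (A n)"
    by (rule real_le_lsqrt[OF Max_A_nonneg Max_A_square_lower[OF assms]])
  show "Max (A n) < sqrt (2 * real n)"
    by (rule real_less_rsqrt[OF Max_A_square_less[OF assms]])
qed

end
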